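(* Let $G$ be a connected simple graph of order at least $2$. Then $\partial(G)=\partial(\operatorname{S}(G))$ if and only if $G\cong S_n$.
   Context: For a simple graph $G$ and $D\subseteq V(G)$, let $B_G(D)$ be the set of vertices in $V(G)\setminus D$ that have a neighbour in $D$, and let $\partial(D)=|B_G(D)|-|D|$. The differential of $G$ is $\partial(G)=\max\{\partial(D): D\subseteq V(G)\}$. The subdivision graph $\operatorname{S}(G)$ is the bipartite graph with vertex set the disjoint union $V(G)\cup E(G)$ in which $v\in V(G)$ and $e\in E(G)$ are adjacent if and only if $e$ is incident with $v$ in $G$ (equivalently, $\operatorname{S}(G)$ is obtained from $G$ by inserting one additional vertex into each edge of $G$). $S_n$ denotes the star graph of order $n$, i.e. $K_{1,n-1}$, where $n$ is the order of $G$.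
   Formalization: The right-hand side is strengthened to "G has order n at least 3 and G ≅ S_n", because the claim fails for G = K_2 = S_2, where ∂(G) = 0 but ∂(S(G)) = 1. *)

theory Defs
  imports "Graph_Theory.Graph_Theory"
begin

text \<open>
  A finite simple graph is a \<open>pair_graph\<close>: every undirected edge \<open>{u, v}\<close> is represented by the
  two arcs \<open>(u, v)\<close> and \<open>(v, u)\<close>.
\<close>

definition boundary :: "'a pair_pre_digraph \<Rightarrow> 'a set \<Rightarrow> 'a set" where
  "boundary G D = {v \<in> pverts G - D. \<exists>u\<in>D. (u, v) \<in> parcs G}"

definition set_differential :: "'a pair_pre_digraph \<Rightarrow> 'a set \<Rightarrow> int" where
  "set_differential G D = int (card (boundary G D)) - int (card D)"

definition differential :: "'a pair_pre_digraph \<Rightarrow> int" where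
  "differential G = Max {set_differential G D | D. D \<subseteq> pverts G}"

definition edges :: "'a pair_pre_digraph \<Rightarrow> 'a set set" where
  "edges G = {{u, v} | u v. (u, v) \<in> parcs G}"

definition subdivision_graph :: "'a pair_pre_digraph \<Rightarrow> ('a + 'a set) pair_pre_digraph" where
  "subdivision_graph G =
     \<lparr> pverts = pverts G <+> edges G,
       parcs = {(Inl v, Inr e) | v e. v \<in> pverts G \<and> e \<in> edges G \<and> v \<in> e}
             \<union> {(Inr e, Inl v) | v e. v \<in> pverts G \<and> e \<in> edges G \<and> v \<in> e} \<rparr>"

definition star_graph :: "nat \<Rightarrow> nat pair_pre_digraph" where
  "star_graph n = \<lparr> pverts = {0..<n}, parcs = {0} \<times> {1..<n} \<union> {1..<n} \<times> {0} \<rparr>"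

lemma star_graph_complete_bipartite:
  assumes "n \<ge> 1"
  shows "K\<^bsub>1,n - 1\<^esub> (with_proj (star_graph n))"
proof -
  have "pverts (star_graph n) = {0} \<union> {1..<n}"
    using assms by (auto simp: star_graph_def)
  moreover have "parcs (star_graph n) = {0} \<times> {1..<n} \<union> {1..<n} \<times> {0}"
    by (simp add: star_graph_def)
  moreover have "{0} \<inter> {1..<n} = {}" "card {0::nat} = 1" "card {1..<n} = n - 1"
    by simp_all
  ultimately show ?thesis
    unfolding complete_bipartite_digraph_pair_def
    by (metis finite_Un finite.emptyI finite_insert finite_atLeastLessThan)
qed

lemma pair_graph_subdivision_graph:
  assumes "pair_graph G"
  shows "pair_graph (subdivision_graph G)"
proof -
  interpret pair_graph G by fact
  have fE: "finite (edges G)"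
  proof -
    have "edges G = (\<lambda>(u, v). {u, v}) ` parcs G" by (auto simp: edges_def)
    then show ?thesis using pair_finite_arcs by simp
  qed
  have fV: "finite (pverts (subdivision_graph G))"
    using fE pair_finite_verts by (simp add: subdivision_graph_def)
  have sub: "parcs (subdivision_graph G)
      \<subseteq> pverts (subdivision_graph G) \<times> pverts (subdivision_graph G)"
    by (auto simp: subdivision_graph_def)
  have fA: "finite (parcs (subdivision_graph G))"
    using finite_subset[OF sub] fV by blast
  show ?thesis
    using fV fA sub
    by unfold_locales (auto simp: subdivision_graph_def symmetric_def intro!: symI)
qed

lemma differential_eqI:
  assumes "finite (pverts G)" "D \<subseteq> pverts G" "set_differential G D = k"
    and "\<And>D. D \<subseteq> pverts G \<Longrightarrow> set_differential G D \<le> k"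
  shows "differential G = k"
proof -
  have "{set_differential G D | D. D \<subseteq> pverts G} = set_differential G ` Pow (pverts G)" by auto
  then show ?thesis
    unfolding differential_def using assms by (intro Max_eqI) auto
qed

text \<open>
  The star of order 2 differs from all other stars: it is \<open>K\<^sub>2\<close>, with differential 0, while its
  subdivision graph is the path on three vertices, with differential 1. It is therefore excluded
  in any characterisation of \<open>differential G = differential (subdivision_graph G)\<close> by stars.
\<close>

lemma differential_star_graph_2:
  "differential (star_graph 2) = 0"
  "differential (subdivision_graph (star_graph 2)) = 1"
proof -
  let ?G = "star_graph 2"
  have G: "?G = \<lparr> pverts = {0, 1}, parcs = {(0, 1), (1, 0)} \<rparr>"
    by (auto simp: star_graph_def)
  have E: "edges ?G = {{0, 1}}" by (auto simp: G edges_def)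
  show "differential ?G = 0"
  proof (rule differential_eqI[where D = "{}"])
    fix D assume "D \<subseteq> pverts ?G"
    then have D: "D \<in> Pow {0, 1}" by (simp add: G)
    have "Pow {0, 1::nat} = {{}, {0}, {1}, {0, 1}}" by (auto simp: Pow_insert)
    with D consider "D = {}" | "D = {0}" | "D = {1}" | "D = {0, 1}" by blast
    then show "set_differential ?G D \<le> 0"
    proof cases
      case 1 then show ?thesis by (simp add: set_differential_def boundary_def)
    next
      case 2
      then have "boundary ?G D = {1}" by (auto simp: boundary_def G)
      then show ?thesis using 2 by (simp add: set_differential_def)
    next
      case 3
      then have "boundary ?G D = {0}" by (auto simp: boundary_def G)
      then show ?thesis using 3 by (simp add: set_differential_def)
    next
      case 4
      then have "boundary ?G D = {}" by (auto simp: boundary_def G)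
      then show ?thesis using 4 by (simp add: set_differential_def)
    qed
  qed (auto simp: G set_differential_def boundary_def)
  let ?S = "subdivision_graph ?G"
  let ?m = "Inr {0, 1} :: nat + nat set"
  have V: "pverts ?S = {Inl 0, Inl 1, ?m}"
    by (simp_all add: subdivision_graph_def E, auto simp: G)
  have A: "(?m, Inl 0) \<in> parcs ?S" "(?m, Inl 1) \<in> parcs ?S"
    by (simp_all add: subdivision_graph_def E, auto simp: G)
  show "differential ?S = 1"
  proof (rule differential_eqI[where D = "{?m}"])
    show "finite (pverts ?S)" "{?m} \<subseteq> pverts ?S" by (auto simp: V)
    have "boundary ?S {?m} = {Inl 0, Inl 1}" using A by (auto simp: boundary_def V)
    then show "set_differential ?S {?m} = 1" by (simp add: set_differential_def)
  next
    fix D assume D: "D \<subseteq> pverts ?S"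
    show "set_differential ?S D \<le> 1"
    proof (cases "D = {}")
      case True
      then show ?thesis by (simp add: set_differential_def boundary_def)
    next
      case False
      have fin: "finite D" using D by (auto simp: V intro: finite_subset)
      then have pos: "card D \<ge> 1" using False by (simp add: Suc_leI card_gt_0_iff)
      have "card (boundary ?S D) \<le> card (pverts ?S - D)"
        by (intro card_mono) (auto simp: boundary_def V)
      also have "\<dots> = 3 - card D" using D fin by (simp add: card_Diff_subset V)
      finally show ?thesis using pos by (simp add: set_differential_def)
    qed
  qed
qed

end

theory Submission
  imports Defs
begin

text \<open>
  Let \<open>D\<close> be a set of vertices with the greatest differential in \<open>G\<close>. Used as a set of vertices
  of the subdivision, it has as boundary the edges meeting \<open>D\<close>. Choosing for each boundary
  vertex in \<open>G\<close> an edge to \<open>D\<close> shows that there are at least as many of these edges as boundary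
  vertices, so the differential never decreases under subdivision.

  Suppose that it does not increase either (\<open>differential_eq_subdivisionD\<close>). Then the chosen edges
  are all the edges meeting \<open>D\<close>: the set \<open>D\<close> is independent, and no vertex has two neighbours in
  \<open>D\<close>. Moreover every edge meets \<open>D\<close>, because the subdivision vertex of an edge missing \<open>D\<close>
  could be added to \<open>D\<close>; it costs one and brings the two ends of the edge into the boundary. In
  other words, \<open>G\<close> is a disjoint union of stars centred at the vertices of \<open>D\<close>, and a
  connected graph of this kind is a single star (\<open>connected_perfect_cover_imp_star\<close>). A star of
  order \<open>n\<close> yields \<open>n - 2\<close>, whereas the subdivision has differential at least 1 as soon as
  there is an edge; hence \<open>n \<ge> 3\<close>.

  Conversely, the centre of a star of order \<open>n\<close> has differential \<open>n - 2\<close>, and it remains to see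
  that no set does better in the subdivided star (\<open>set_differential_subdivided_star_le\<close>). The
  subdivided star consists of the centre and \<open>n - 1\<close> legs of two vertices each, and a leg
  contains at most one boundary vertex.
\<close>

section \<open>Differentials of finite graphs\<close>

lemma differential_ge:
  assumes "finite (pverts G)" "D \<subseteq> pverts G"
  shows "set_differential G D \<le> differential G"
proof -
  have "{set_differential G D | D. D \<subseteq> pverts G} = set_differential G ` Pow (pverts G)" by auto
  then show ?thesis
    unfolding differential_def using assms by (intro Max_ge) auto
qed

lemma differential_attained:
  assumes "finite (pverts G)"
  obtains D where "D \<subseteq> pverts G" "set_differential G D = differential G"
proof -
  have eq: "{set_differential G D | D. D \<subseteq> pverts G} = set_differential G ` Pow (pverts G)" by auto
  have "differential G \<in> {set_differential G D | D. D \<subseteq> pverts G}"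
    unfolding differential_def
    by (rule Max_in) (use assms in \<open>auto simp: eq\<close>)
  then show thesis using that by auto
qed

lemma (in pair_graph) finite_edges: "finite (edges G)"
proof -
  have "edges G = (\<lambda>(u, v). {u, v}) ` parcs G" by (auto simp: edges_def)
  then show ?thesis using pair_finite_arcs by simp
qed

lemma (in pair_graph) edge_iff_arc: "{u, v} \<in> edges G \<longleftrightarrow> (u, v) \<in> parcs G"
  unfolding edges_def using arcs_symmetric by (auto simp: doubleton_eq_iff)

lemma (in pair_graph) finite_pverts_subdivision: "finite (pverts (subdivision_graph G))"
  using finite_edges pair_finite_verts by (simp add: subdivision_graph_def)

section \<open>Comparing a graph with its subdivision\<close>

definition edges_meeting :: "'a pair_pre_digraph \<Rightarrow> 'a set \<Rightarrow> 'a set set" where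
  "edges_meeting G D = {e \<in> edges G. e \<inter> D \<noteq> {}}"

lemma boundary_subdivision_Inl:
  assumes "D \<subseteq> pverts G"
  shows "boundary (subdivision_graph G) (Inl ` D) = Inr ` edges_meeting G D"
  using assms by (auto simp: boundary_def subdivision_graph_def edges_meeting_def)

text \<open>
  The selected edge \<open>{d b, b}\<close> determines \<open>b\<close> as its only end point outside \<open>D\<close>.
\<close>

lemma (in pair_graph) boundary_injects_into_edges_meeting:
  obtains d where "\<And>b. b \<in> boundary G D \<Longrightarrow> d b \<in> D"
    and "inj_on (\<lambda>b. {d b, b}) (boundary G D)"
    and "(\<lambda>b. {d b, b}) ` boundary G D \<subseteq> edges_meeting G D"
proof -
  have "\<forall>b\<in>boundary G D. \<exists>u. u \<in> D \<and> (u, b) \<in> parcs G"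
    by (auto simp: boundary_def)
  then obtain d where d: "\<And>b. b \<in> boundary G D \<Longrightarrow> d b \<in> D \<and> (d b, b) \<in> parcs G"
    by metis
  show thesis
  proof (rule that)
    show "inj_on (\<lambda>b. {d b, b}) (boundary G D)"
    proof (rule inj_onI)
      fix b b' assume b: "b \<in> boundary G D" "b' \<in> boundary G D" "{d b, b} = {d b', b'}"
      then have "b \<notin> D" "d b' \<in> D" using d by (auto simp: boundary_def)
      with b(3) show "b = b'" by (auto simp: doubleton_eq_iff)
    qed
  qed (use d in \<open>auto simp: edges_meeting_def edge_iff_arc\<close>)
qed

lemma (in pair_graph) card_boundary_le_edges_meeting:
  "card (boundary G D) \<le> card (edges_meeting G D)"
  by (rule boundary_injects_into_edges_meeting[of D])
    (rule card_inj_on_le, assumption+, simp add: edges_meeting_def finite_edges)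

text \<open>
  Equality in the preceding bound makes the injection onto, so that every edge meeting \<open>D\<close> is the
  edge selected for its end point outside \<open>D\<close>.
\<close>

lemma (in pair_graph) card_boundary_eq_edges_meetingD:
  assumes "card (boundary G D) = card (edges_meeting G D)"
  shows "u \<in> D \<Longrightarrow> (u, v) \<in> parcs G \<Longrightarrow> v \<notin> D"
    and "u \<in> D \<Longrightarrow> u' \<in> D \<Longrightarrow> (u, v) \<in> parcs G \<Longrightarrow> (u', v) \<in> parcs G \<Longrightarrow> u = u'"
proof -
  obtain d where d: "\<And>b. b \<in> boundary G D \<Longrightarrow> d b \<in> D"
    and inj: "inj_on (\<lambda>b. {d b, b}) (boundary G D)"
    and sub: "(\<lambda>b. {d b, b}) ` boundary G D \<subseteq> edges_meeting G D"
    using boundary_injects_into_edges_meeting[of D] by blast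
  have onto: "(\<lambda>b. {d b, b}) ` boundary G D = edges_meeting G D"
    by (rule card_subset_eq[OF _ sub])
      (simp_all add: edges_meeting_def finite_edges card_image[OF inj] assms[unfolded edges_meeting_def])
  have selected: "v \<notin> D \<and> u = d v" if "u \<in> D" "(u, v) \<in> parcs G" for u v
  proof -
    have "{u, v} \<in> edges_meeting G D"
      using that by (auto simp: edges_meeting_def edge_iff_arc)
    then obtain b where b: "b \<in> boundary G D" "{u, v} = {d b, b}"
      unfolding onto[symmetric] by auto
    moreover have "b \<notin> D" using b(1) by (simp add: boundary_def)
    ultimately show ?thesis using that(1) by (auto simp: doubleton_eq_iff)
  qed
  show "v \<notin> D" if "u \<in> D" "(u, v) \<in> parcs G" using selected that by blast
  show "u = u'" if "u \<in> D" "u' \<in> D" "(u, v) \<in> parcs G" "(u', v) \<in> parcs G"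
    using selected that by metis
qed

lemma (in pair_graph) set_differential_subdivision_Inl:
  assumes "D \<subseteq> pverts G"
  shows "set_differential (subdivision_graph G) (Inl ` D)
    = int (card (edges_meeting G D)) - int (card D)"
  by (simp add: set_differential_def boundary_subdivision_Inl[OF assms] card_image)

lemma (in pair_graph) set_differential_subdivision_add_edge:
  assumes D: "D \<subseteq> pverts G" and xy: "(x, y) \<in> parcs G" "x \<notin> D" "y \<notin> D"
  shows "set_differential (subdivision_graph G) (insert (Inr {x, y}) (Inl ` D))
    = int (card (edges_meeting G D)) - int (card D) + 1"
proof -
  let ?e = "Inr {x, y} :: 'a + 'a set"
  have e: "{x, y} \<in> edges G" using xy by (simp add: edge_iff_arc)
  have V: "x \<in> pverts G" "y \<in> pverts G" using xy in_arcsD1 in_arcsD2 by blast+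
  have "x \<noteq> y" using xy(1) no_loops' by blast
  have "boundary (subdivision_graph G) (insert ?e (Inl ` D))
      = {Inl x, Inl y} \<union> Inr ` edges_meeting G D"
    using D xy e V by (auto simp: boundary_def subdivision_graph_def edges_meeting_def)
  also have "card \<dots> = 2 + card (edges_meeting G D)"
    using \<open>x \<noteq> y\<close>
    by (subst card_Un_disjoint) (auto simp: card_image edges_meeting_def finite_edges)
  finally have "card (boundary (subdivision_graph G) (insert ?e (Inl ` D)))
      = 2 + card (edges_meeting G D)" .
  moreover have "card (insert ?e (Inl ` D)) = card D + 1"
    using finite_subset[OF D pair_finite_verts]
    by (subst card_insert_disjoint) (auto simp: card_image)
  ultimately show ?thesis by (simp add: set_differential_def)
qed

lemma (in pair_graph) differential_le_subdivision:
  "differential G \<le> differential (subdivision_graph G)"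
proof -
  obtain D where D: "D \<subseteq> pverts G" "set_differential G D = differential G"
    using differential_attained[OF pair_finite_verts] .
  have "Inl ` D \<subseteq> pverts (subdivision_graph G)"
    using D(1) by (auto simp: subdivision_graph_def)
  then have "set_differential (subdivision_graph G) (Inl ` D) \<le> differential (subdivision_graph G)"
    by (rule differential_ge[OF finite_pverts_subdivision])
  then show ?thesis
    using card_boundary_le_edges_meeting[of D] D
    by (simp add: set_differential_subdivision_Inl) (simp add: set_differential_def)
qed

text \<open>
  The vertices of an optimal set, kept in the subdivision, already do as well there as in the
  graph. An edge missed by the set would supply one more vertex with two new boundary vertices,
  so equality of the differentials leaves no slack anywhere.
\<close>

lemma (in pair_graph) differential_eq_subdivisionD:
  assumes eq: "differential G = differential (subdivision_graph G)"
    and D: "D \<subseteq> pverts G" "set_differential G D = differential G"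
  shows "card (boundary G D) = card (edges_meeting G D)"
    and "(x, y) \<in> parcs G \<Longrightarrow> x \<in> D \<or> y \<in> D"
proof -
  let ?S = "subdivision_graph G"
  have "Inl ` D \<subseteq> pverts ?S" using D(1) by (auto simp: subdivision_graph_def)
  then have "set_differential ?S (Inl ` D) \<le> differential ?S"
    by (rule differential_ge[OF finite_pverts_subdivision])
  then have "int (card (edges_meeting G D)) - int (card D) \<le> set_differential G D"
    using eq D by (simp add: set_differential_subdivision_Inl)
  then show *: "card (boundary G D) = card (edges_meeting G D)"
    using card_boundary_le_edges_meeting[of D] by (simp add: set_differential_def)
  show "x \<in> D \<or> y \<in> D" if xy: "(x, y) \<in> parcs G"
  proof (rule ccontr)
    assume no: "\<not> (x \<in> D \<or> y \<in> D)"
    have "insert (Inr {x, y}) (Inl ` D) \<subseteq> pverts ?S"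
      using D(1) xy by (auto simp: subdivision_graph_def edge_iff_arc)
    then have "set_differential ?S (insert (Inr {x, y}) (Inl ` D)) \<le> differential ?S"
      by (rule differential_ge[OF finite_pverts_subdivision])
    then show False
      using no xy D eq * by (simp add: set_differential_subdivision_add_edge)
        (simp add: set_differential_def)
  qed
qed

section \<open>Stars\<close>

definition star_centred_at :: "'a pair_pre_digraph \<Rightarrow> 'a \<Rightarrow> bool" where
  "star_centred_at G c \<longleftrightarrow> c \<in> pverts G \<and>
     parcs G = {c} \<times> (pverts G - {c}) \<union> (pverts G - {c}) \<times> {c}"

lemma star_centred_at_imp_iso_star_graph:
  assumes G: "pair_graph G" and c: "star_centred_at G c"
  shows "digraph_iso (with_proj G) (with_proj (star_graph (card (pverts G))))"
proof -
  interpret pair_graph G by fact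
  let ?V = "pverts G" and ?n = "card (pverts G)"
  obtain g where g: "bij_betw g ?V {0..<?n}"
    using ex_bij_betw_finite_nat[OF pair_finite_verts] by blast
  have cV: "c \<in> ?V" using c by (simp add: star_centred_at_def)
  then have "0 \<in> {0..<?n}" using pair_finite_verts by (auto simp: card_gt_0_iff)
  moreover have "g c \<in> {0..<?n}" using g cV by (rule bij_betwE[THEN bspec])
  ultimately have t: "bij_betw (transpose 0 (g c)) {0..<?n} {0..<?n}"
    by simp
  define h where "h = transpose 0 (g c) \<circ> g"
  have h: "bij_betw h ?V {0..<?n}" unfolding h_def using g t by (rule bij_betw_trans)
  have hc: "h c = 0" by (simp add: h_def)
  have inj: "inj_on h ?V" and im: "h ` ?V = {0..<?n}" using h by (auto simp: bij_betw_def)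
  have leaves: "h ` (?V - {c}) = {1..<?n}"
    using inj_on_image_set_diff[OF inj, of ?V "{c}"] cV im hc by auto
  have arcs: "map_prod h h ` parcs G = parcs (star_graph ?n)"
  proof -
    have "map_prod h h ` ({c} \<times> (?V - {c})) = {0} \<times> {1..<?n}"
      by (rule map_prod_surj_on) (simp_all add: hc leaves)
    moreover have "map_prod h h ` ((?V - {c}) \<times> {c}) = {1..<?n} \<times> {0}"
      by (rule map_prod_surj_on) (simp_all add: hc leaves)
    ultimately show ?thesis
      using c by (simp add: star_centred_at_def star_graph_def image_Un)
  qed
  have "parcs G \<subseteq> ?V \<times> ?V" using in_arcsD1 in_arcsD2 by auto
  then have inj2: "inj_on (map_prod h h) (parcs G)"
    using map_prod_inj_on[OF inj inj] inj_on_subset by blast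
  let ?f = "\<lparr> iso_verts = h, iso_arcs = map_prod h h, iso_head = snd, iso_tail = fst \<rparr>"
  have "pre_digraph.digraph_isomorphism (with_proj G) ?f"
    using inj inj2 wf_digraph_wp_iff[of G] pair_wf_digraph_axioms
    by (simp add: pre_digraph.digraph_isomorphism_def)
  moreover have "with_proj (star_graph ?n) = app_iso ?f (with_proj G)"
    using im arcs by (simp add: app_iso_def with_proj_def star_graph_def)
  ultimately show ?thesis unfolding digraph_iso_def by blast
qed

lemma iso_star_graph_imp_star_centred_at:
  assumes G: "pair_graph G" and ne: "pverts G \<noteq> {}"
    and iso: "digraph_iso (with_proj G) (with_proj (star_graph (card (pverts G))))"
  obtains c where "star_centred_at G c"
proof -
  interpret pair_graph G by fact
  let ?V = "pverts G" and ?n = "card (pverts G)"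
  obtain f where f: "pre_digraph.digraph_isomorphism (with_proj G) f"
    and H: "with_proj (star_graph ?n) = app_iso f (with_proj G)"
    using iso unfolding digraph_iso_def by blast
  define h where "h = iso_verts f"
  have inj: "inj_on h ?V"
    using pre_digraph.digraph_isomorphism_inj_on_verts[OF f] by (simp add: h_def)
  have "pverts (star_graph ?n) = h ` ?V" using arg_cong[OF H, of verts] by (simp add: h_def)
  then have im: "h ` ?V = {0..<?n}" by (simp add: star_graph_def)
  have "parcs (star_graph ?n) = map_prod h h ` parcs G"
    using arg_cong[OF H, of arcs_ends] wf_digraph.arcs_ends_app_iso_eq[OF _ f] wf_digraph_wp_iff[of G]
      pair_wf_digraph_axioms
    by (simp add: h_def map_prod_def)
  then have arcs: "map_prod h h ` parcs G = {0} \<times> {1..<?n} \<union> {1..<?n} \<times> {0}"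
    by (simp add: star_graph_def)
  have "0 \<in> h ` ?V" using im ne pair_finite_verts by (auto simp: card_gt_0_iff)
  then obtain c where c: "c \<in> ?V" "h c = 0" by auto
  have sub: "parcs G \<subseteq> ?V \<times> ?V" using in_arcsD1 in_arcsD2 by auto
  have leaf: "h u \<in> {1..<?n} \<longleftrightarrow> u \<noteq> c" and centre: "h u = 0 \<longleftrightarrow> u = c" if "u \<in> ?V" for u
  proof -
    show centre: "h u = 0 \<longleftrightarrow> u = c" using inj_onD[OF inj, of u c] c that by auto
    have "h u \<in> {0..<?n}" using im that by auto
    then show "h u \<in> {1..<?n} \<longleftrightarrow> u \<noteq> c" using centre by auto
  qed
  have adj: "(u, v) \<in> parcs G \<longleftrightarrow> u = c \<and> v \<noteq> c \<or> u \<noteq> c \<and> v = c" if "u \<in> ?V" "v \<in> ?V" for u v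
  proof -
    have "(u, v) \<in> parcs G \<longleftrightarrow> map_prod h h (u, v) \<in> map_prod h h ` parcs G"
      using inj_on_image_mem_iff[OF map_prod_inj_on[OF inj inj] _ sub, of "(u, v)"] that by simp
    then show ?thesis
      unfolding arcs
      using leaf[OF that(1)] leaf[OF that(2)] centre[OF that(1)] centre[OF that(2)]
      by (simp del: atLeastLessThan_iff)
  qed
  have "star_centred_at G c"
    unfolding star_centred_at_def using c(1) adj sub by (auto 4 4)
  then show thesis by (rule that)
qed

lemma (in pair_graph) connected_closed_set_eq_pverts:
  assumes conn: "Digraph_Component.connected (with_proj G)"
    and X: "c \<in> X" "X \<subseteq> pverts G"
    and closed: "\<And>u v. u \<in> X \<Longrightarrow> (u, v) \<in> parcs G \<Longrightarrow> v \<in> X"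
  shows "X = pverts G"
proof
  show "pverts G \<subseteq> X"
  proof
    fix v assume "v \<in> pverts G"
    then have "c \<rightarrow>\<^sup>*\<^bsub>with_proj G\<^esub> v"
      using symmetric_connected_imp_strongly_connected[OF sym_arcs conn] X
      by (auto simp: strongly_connected_def)
    then show "v \<in> X"
      by (induction rule: reachable_induct) (use X closed in auto)
  qed
qed (use X in simp)

text \<open>
  The neighbours of a vertex \<open>c\<close> of \<open>D\<close> lie outside \<open>D\<close>, so all their edges lead back into
  \<open>D\<close>, and then to \<open>c\<close> itself. Hence \<open>c\<close> together with its neighbours is a whole component.
\<close>

lemma (in pair_graph) connected_perfect_cover_imp_star:
  assumes conn: "Digraph_Component.connected (with_proj G)"
    and D: "c \<in> D" "D \<subseteq> pverts G"
    and independent: "\<And>u v. u \<in> D \<Longrightarrow> (u, v) \<in> parcs G \<Longrightarrow> v \<notin> D"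
    and unique: "\<And>u u' v. u \<in> D \<Longrightarrow> u' \<in> D \<Longrightarrow> (u, v) \<in> parcs G \<Longrightarrow> (u', v) \<in> parcs G \<Longrightarrow> u = u'"
    and cover: "\<And>u v. (u, v) \<in> parcs G \<Longrightarrow> u \<in> D \<or> v \<in> D"
  shows "star_centred_at G c" "D = {c}"
proof -
  let ?X = "insert c {v. (c, v) \<in> parcs G}"
  have X: "?X = pverts G"
  proof (rule connected_closed_set_eq_pverts[OF conn, where c = c])
    show "?X \<subseteq> pverts G" using D in_arcsD2 by auto
    fix u v assume u: "u \<in> ?X" and uv: "(u, v) \<in> parcs G"
    show "v \<in> ?X"
    proof (cases "u = c")
      case False
      with u have cu: "(c, u) \<in> parcs G" by simp
      then have "v \<in> D" using independent[OF D(1)] cover[OF uv] by blast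
      moreover have "(v, u) \<in> parcs G" using uv arcs_symmetric by blast
      ultimately show ?thesis using unique[OF D(1) _ cu] by blast
    qed (use uv in simp)
  qed simp
  show Dc: "D = {c}" using X D independent[OF D(1)] by auto
  have "parcs G = {c} \<times> (pverts G - {c}) \<union> (pverts G - {c}) \<times> {c}"
  proof (intro set_eqI iffI)
    fix a assume a: "a \<in> parcs G"
    obtain u v where uv: "a = (u, v)" by (cases a)
    then have "u \<in> pverts G" "v \<in> pverts G" "u \<noteq> v"
      using a in_arcsD1 in_arcsD2 no_loops' by blast+
    moreover have "u = c \<or> v = c" using cover a uv Dc by blast
    ultimately show "a \<in> {c} \<times> (pverts G - {c}) \<union> (pverts G - {c}) \<times> {c}"
      using uv by auto
  next
    fix a assume "a \<in> {c} \<times> (pverts G - {c}) \<union> (pverts G - {c}) \<times> {c}"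
    then obtain v where v: "v \<in> pverts G" "v \<noteq> c" "a = (c, v) \<or> a = (v, c)" by auto
    then have "(c, v) \<in> parcs G" using X by blast
    then show "a \<in> parcs G" using v arcs_symmetric by blast
  qed
  then show "star_centred_at G c" using D by (auto simp: star_centred_at_def)
qed

section \<open>The differentials of a star and of its subdivision\<close>

lemma boundary_star:
  assumes "star_centred_at G c"
  shows "boundary G {c} = pverts G - {c}"
  using assms by (auto simp: boundary_def star_centred_at_def)

lemma set_differential_star_centre:
  assumes "star_centred_at G c" "finite (pverts G)"
  shows "set_differential G {c} = int (card (pverts G)) - 2"
proof -
  have "c \<in> pverts G" using assms by (simp add: star_centred_at_def)
  then have "card (pverts G) = Suc (card (pverts G - {c}))"
    using assms(2) by (metis card.remove)
  then show ?thesis by (simp add: set_differential_def boundary_star[OF assms(1)])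
qed

lemma edges_star:
  assumes "star_centred_at G c"
  shows "edges G = (\<lambda>v. {c, v}) ` (pverts G - {c})"
  using assms by (auto simp: edges_def star_centred_at_def insert_commute)

text \<open>
  Without its centre \<open>c\<close>, the subdivided star falls apart into legs, each consisting of a leaf
  \<open>v\<close> and the subdivision vertex of \<open>{c, v}\<close>; \<open>leg c\<close> maps both of them to \<open>v\<close>.
\<close>

definition leg :: "'a \<Rightarrow> 'a + 'a set \<Rightarrow> 'a" where
  "leg c x = (case x of Inl v \<Rightarrow> v | Inr e \<Rightarrow> the_elem (e - {c}))"

lemma leg_simps [simp]:
  "leg c (Inl v) = v"
  "v \<noteq> c \<Longrightarrow> leg c (Inr {c, v}) = v"
proof -
  assume "v \<noteq> c"
  then have "{c, v} - {c} = {v}" by auto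
  then show "leg c (Inr {c, v}) = v" by (simp add: leg_def)
qed (simp add: leg_def)

lemma subdivided_star_cases:
  assumes "star_centred_at G c" "x \<in> pverts (subdivision_graph G)"
  obtains "x = Inl c"
    | v where "v \<in> pverts G" "v \<noteq> c" "x = Inl v"
    | v where "v \<in> pverts G" "v \<noteq> c" "x = Inr {c, v}"
  using assms by (auto simp: subdivision_graph_def edges_star)

lemma subdivided_star_neighbour:
  assumes "star_centred_at G c" "v \<noteq> c"
  shows "(y, Inl v) \<in> parcs (subdivision_graph G) \<Longrightarrow> y = Inr {c, v}"
    and "(y, Inr {c, v}) \<in> parcs (subdivision_graph G) \<Longrightarrow> y = Inl c \<or> y = Inl v"
  using assms by (auto simp: subdivision_graph_def edges_star)

text \<open>
  If the leaf of a leg is a boundary vertex, then its only neighbour, the subdivision vertex of the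
  leg, is in \<open>D\<close> and therefore not in the boundary.
\<close>

lemma inj_on_leg_boundary:
  assumes star: "star_centred_at G c"
  shows "inj_on (leg c) (boundary (subdivision_graph G) D - {Inl c})"
proof -
  let ?B = "boundary (subdivision_graph G) D"
  have mixed: False if "Inl v \<in> ?B" "Inr {c, v} \<in> ?B" "v \<noteq> c" for v
    using that subdivided_star_neighbour(1)[OF star] by (auto simp: boundary_def)
  show ?thesis
  proof (rule inj_onI)
    fix x y assume x: "x \<in> ?B - {Inl c}" and y: "y \<in> ?B - {Inl c}" and xy: "leg c x = leg c y"
    have "x \<in> pverts (subdivision_graph G)" "y \<in> pverts (subdivision_graph G)"
      using x y by (auto simp: boundary_def)
    then show "x = y"
      using x y xy mixed
      by (elim subdivided_star_cases[OF star]) auto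
  qed
qed

text \<open>
  If \<open>D\<close> contains the centre, which costs one, each of the \<open>n - 1\<close> legs contributes at most one
  boundary vertex. Otherwise every leg pays for its boundary vertex with a vertex of \<open>D\<close>, and only
  the centre can come for free: the differential is then at most 1, and \<open>1 \<le> n - 2\<close> for
  \<open>n \<ge> 3\<close>.
\<close>

lemma set_differential_subdivided_star_le:
  assumes G: "pair_graph G" and star: "star_centred_at G c" and n: "card (pverts G) \<ge> 3"
    and D: "D \<subseteq> pverts (subdivision_graph G)"
  shows "set_differential (subdivision_graph G) D \<le> int (card (pverts G)) - 2"
proof -
  interpret pair_graph G by fact
  let ?S = "subdivision_graph G"
  let ?B = "boundary ?S D"
  have c: "c \<in> pverts G" using star by (simp add: star_centred_at_def)
  have finB: "finite ?B"
    by (rule finite_subset[OF _ finite_pverts_subdivision]) (auto simp: boundary_def)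
  have finD: "finite D" using D finite_pverts_subdivision by (rule finite_subset)
  have B_cases: thesis if "x \<in> ?B - {Inl c}"
    and "\<And>v. \<lbrakk>v \<in> pverts G; v \<noteq> c; x = Inl v\<rbrakk> \<Longrightarrow> thesis"
    and "\<And>v. \<lbrakk>v \<in> pverts G; v \<noteq> c; x = Inr {c, v}\<rbrakk> \<Longrightarrow> thesis" for x thesis
  proof -
    have "x \<in> pverts ?S" "x \<noteq> Inl c" using that(1) by (auto simp: boundary_def)
    then show thesis by (elim subdivided_star_cases[OF star]) (use that in blast)+
  qed
  have inj: "card (?B - {Inl c}) = card (leg c ` (?B - {Inl c}))"
    by (rule card_image[symmetric]) (rule inj_on_leg_boundary[OF star])
  show ?thesis
  proof (cases "Inl c \<in> D")
    case True
    have "leg c ` (?B - {Inl c}) \<subseteq> pverts G - {c}"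
    proof (rule image_subsetI)
      fix x assume "x \<in> ?B - {Inl c}"
      then show "leg c x \<in> pverts G - {c}" by (rule B_cases) auto
    qed
    then have "card (?B - {Inl c}) \<le> card (pverts G - {c})"
      unfolding inj by (rule card_mono[rotated]) (simp add: pair_finite_verts)
    moreover have "?B - {Inl c} = ?B" using True by (auto simp: boundary_def)
    moreover have "card (pverts G) = Suc (card (pverts G - {c}))"
      using c pair_finite_verts by (metis card.remove)
    moreover have "card D \<ge> 1" using True finD by (auto simp: Suc_le_eq card_gt_0_iff)
    ultimately show ?thesis by (simp add: set_differential_def)
  next
    case False
    \<comment> \<open>A boundary vertex on a leg has its neighbour in \<open>D\<close> on the same leg.\<close>
    have "leg c ` (?B - {Inl c}) \<subseteq> leg c ` D"
    proof (rule image_subsetI)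
      fix x assume x: "x \<in> ?B - {Inl c}"
      then obtain y where y: "y \<in> D" "(y, x) \<in> parcs ?S" by (auto simp: boundary_def)
      from x have "leg c x = leg c y"
      proof (rule B_cases)
        fix v assume "v \<in> pverts G" "v \<noteq> c" "x = Inl v"
        then show ?thesis using y subdivided_star_neighbour(1)[OF star] by fastforce
      next
        fix v assume "v \<in> pverts G" "v \<noteq> c" "x = Inr {c, v}"
        then show ?thesis using y False subdivided_star_neighbour(2)[OF star] by fastforce
      qed
      with y show "leg c x \<in> leg c ` D" by blast
    qed
    then have "card (?B - {Inl c}) \<le> card (leg c ` D)"
      unfolding inj using finD by (intro card_mono) auto
    also have "\<dots> \<le> card D" using finD by (rule card_image_le)
    finally have "card (?B - {Inl c}) \<le> card D" .
    moreover have "card ?B \<le> card (?B - {Inl c}) + 1"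
      unfolding card_Diff_singleton_if by (split if_split) arith
    ultimately show ?thesis using n by (simp add: set_differential_def)
  qed
qed

section \<open>Graphs with the differential of their subdivision\<close>

theorem proposition2p21:
  fixes G :: "'a pair_pre_digraph"
  assumes "pair_graph G"
    and "Digraph_Component.connected (with_proj G)"
    and "card (pverts G) \<ge> 2"
  shows "differential G = differential (subdivision_graph G) \<longleftrightarrow>
           card (pverts G) \<ge> 3 \<and>
           digraph_iso (with_proj G) (with_proj (star_graph (card (pverts G))))"
proof
  interpret pair_graph G by fact
  let ?S = "subdivision_graph G"
  assume eq: "differential G = differential ?S"
  have "parcs G \<noteq> {}"
  proof
    assume no: "parcs G = {}"
    obtain v where "v \<in> pverts G" using assms(3) by fastforce
    then have "{v} = pverts G"
      by (intro connected_closed_set_eq_pverts[OF assms(2)]) (auto simp: no)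
    then have "card (pverts G) = 1" by (metis card_1_singleton_iff One_nat_def)
    then show False using assms(3) by simp
  qed
  then obtain x y where xy: "(x, y) \<in> parcs G" by auto
  obtain D where D: "D \<subseteq> pverts G" "set_differential G D = differential G"
    using differential_attained[OF pair_finite_verts] .
  note tight = differential_eq_subdivisionD[OF eq D]
  obtain c where c: "c \<in> D" using tight(2)[OF xy] by blast
  note perfect = card_boundary_eq_edges_meetingD[OF tight(1)]
  have star: "star_centred_at G c" and Dc: "D = {c}"
    by (rule connected_perfect_cover_imp_star[OF assms(2) c D(1)];
        fact perfect(1) perfect(2) tight(2))+
  have "differential G = int (card (pverts G)) - 2"
    using set_differential_star_centre[OF star pair_finite_verts] D Dc by simp
  \<comment> \<open>The subdivision vertex of a single edge has the two ends of that edge as its boundary,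
    which rules out the star of order 2.\<close>
  moreover have "1 \<le> differential ?S"
  proof -
    have "{Inr {x, y}} \<subseteq> pverts ?S"
      using xy by (auto simp: subdivision_graph_def edge_iff_arc)
    then have "set_differential ?S {Inr {x, y}} \<le> differential ?S"
      by (rule differential_ge[OF finite_pverts_subdivision])
    then show ?thesis
      using set_differential_subdivision_add_edge[of "{}" x y] xy by simp
  qed
  ultimately have "card (pverts G) \<ge> 3" using eq by linarith
  then show "card (pverts G) \<ge> 3 \<and>
      digraph_iso (with_proj G) (with_proj (star_graph (card (pverts G))))"
    using star_centred_at_imp_iso_star_graph[OF assms(1) star] by blast
next
  interpret pair_graph G by fact
  let ?S = "subdivision_graph G"
  assume "card (pverts G) \<ge> 3 \<and>
      digraph_iso (with_proj G) (with_proj (star_graph (card (pverts G))))"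
  then have n: "card (pverts G) \<ge> 3"
    and iso: "digraph_iso (with_proj G) (with_proj (star_graph (card (pverts G))))" by auto
  have "pverts G \<noteq> {}" using n by auto
  then obtain c where star: "star_centred_at G c"
    using iso_star_graph_imp_star_centred_at[OF assms(1) _ iso] by blast
  then have "{c} \<subseteq> pverts G" by (simp add: star_centred_at_def)
  then have "set_differential G {c} \<le> differential G"
    by (rule differential_ge[OF pair_finite_verts])
  then have "int (card (pverts G)) - 2 \<le> differential G"
    using set_differential_star_centre[OF star pair_finite_verts] by simp
  moreover obtain D where "D \<subseteq> pverts ?S" "set_differential ?S D = differential ?S"
    using differential_attained[OF finite_pverts_subdivision] .
  then have "differential ?S \<le> int (card (pverts G)) - 2"
    using set_differential_subdivided_star_le[OF assms(1) star n] by metis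
  ultimately show "differential G = differential ?S"
    using differential_le_subdivision by linarith
qed

end
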